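(* Let $\mathbb U(t)$ be the random brickwork circuit on $2L$ qubits built from a fixed $U\in U(4)$ and independent uniformly random phases, and let $$K_g(t)=\mathbb E\big[|\mathrm{tr}_{\rm sector}\,\mathbb U(t)|^2\big],\qquad t>0,$$ be its generalised spectral form factor, where the trace is reduced to a common eigenspace of $\mathbb U(t)$ and all its commuting symmetries. Assume that there are no conserved charges (so that the trace is over the whole Hilbert space). Then $$K_g(t)=\sum_{m=0}^{2L}K_g^{(m)}(t)=1+K_g^{(1)}(t)+\dots+K_g^{(2L)}(t),\qquad K^{(0)}_g(t)=1,$$ where $$K_g^{(m)}(t)=\sum_{x_1<\dots<x_m}\big\langle \bullet_{x_1}\cdots\bullet_{x_m}\big|\bullet_{x_1}\cdots\bullet_{x_m}(t)\big\rangle_L ,$$ the sum running over all $m$-element subsets $\{x_1<\dots<x_m\}$ of the $2L$ sites. That is, $K_g^{(m)}(t)$ is the sum of the averaged autocorrelation functions of the operators $\sigma^z_{x_1}\cdots\sigma^z_{x_m}$ in finite volume $L$.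
   Context: Sites: there are $2L$ qubits at positions $x\in\{0,\tfrac12,1,\dots,L-\tfrac12\}$ with periodic boundary conditions ($x$ taken mod $L$); the Hilbert space is $(\mathbb C^2)^{\otimes 2L}$. One time step consists of two layers: first, two-qubit gates act on all pairs $(x+\tfrac12,x+1)$, then two-qubit gates act on all pairs $(x,x+\tfrac12)$, with $x\in\mathbb Z_L$. $\mathbb U(t)$ is the product of $t$ such time steps ($2t$ layers). Each gate has the form $(e^{i\phi\sigma^z}\otimes e^{i\phi'\sigma^z})\,U$ with $U\in U(4)$ a fixed matrix (the same for every gate; first tensor factor = left site of the pair), where all the phases $\phi,\phi'$ (two for each gate of each layer) are independent and uniform on $[-\pi,\pi]$. $\mathbb E$ is the expectation over all phases. Averaged dynamical correlations in the infinite temperature state: for sets of sites $\{x_i\}$, $\{y_j\}$, $$\langle \bullet_{x_1}\cdots\bullet_{x_m}|\bullet_{y_1}\cdots\bullet_{y_n}(t)\rangle_L=\mathbb E\Big[2^{-2L}\,\mathrm{tr}\Big(\sigma^z_{x_1}\cdots\sigma^z_{x_m}\;\mathbb U(t)^\dagger\,\sigma^z_{y_1}\cdots\sigma^z_{y_n}\,\mathbb U(t)\Big)\Big],$$ where $\sigma^z_x$ is the Pauli matrix $\sigma^z$ acting at site $x$ (an empty product is the identity). *)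

theory Defs
  imports "HOL-Probability.Probability" "Jordan_Normal_Form.Schur_Decomposition"
begin

section \<open>Matrices\<close>

definition mat_trace :: "complex mat \<Rightarrow> complex" where
  "mat_trace A = (\<Sum>i<dim_row A. A $$ (i, i))"

definition mat_unitary :: "nat \<Rightarrow> complex mat \<Rightarrow> bool" where
  "mat_unitary n A \<longleftrightarrow> A \<in> carrier_mat n n \<and> mat_adjoint A * A = 1\<^sub>m n"

definition mat_hermitian :: "nat \<Rightarrow> complex mat \<Rightarrow> bool" where
  "mat_hermitian n A \<longleftrightarrow> A \<in> carrier_mat n n \<and> mat_adjoint A = A"

definition kron :: "complex mat \<Rightarrow> complex mat \<Rightarrow> complex mat" where
  "kron A B = Matrix.mat (dim_row A * dim_row B) (dim_col A * dim_col B)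
     (\<lambda>(i, j). A $$ (i div dim_row B, j div dim_col B) * B $$ (i mod dim_row B, j mod dim_col B))"

text \<open>Ordered product \<open>f x\<^sub>1 * \<dots> * f x\<^sub>k\<close> of \<open>N \<times> N\<close> matrices over a list.\<close>

definition mat_list_prod :: "nat \<Rightarrow> ('i \<Rightarrow> complex mat) \<Rightarrow> 'i list \<Rightarrow> complex mat" where
  "mat_list_prod N f xs = foldr (\<lambda>x A. f x * A) xs (1\<^sub>m N)"

definition orth_projector :: "nat \<Rightarrow> complex Matrix.vec set \<Rightarrow> complex mat" where
  "orth_projector N V = (THE P. mat_hermitian N P \<and> P * P = P \<and> (\<lambda>v. P *\<^sub>v v) ` carrier_vec N = V)"

definition sector_trace :: "nat \<Rightarrow> complex Matrix.vec set \<Rightarrow> complex mat \<Rightarrow> complex" where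
  "sector_trace N V A = mat_trace (orth_projector N V * A)"


section \<open>The Hilbert space of \<open>2L\<close> qubits and local operators\<close>

text \<open>
  The site at position \<open>x\<close> in \<open>{0, 1/2, 1, \<dots>, L - 1/2}\<close> carries the number \<open>2x < 2L\<close>.
  The computational basis of the \<open>2L\<close> qubits is indexed by \<open>k < 2 ^ (2L)\<close>, where bit \<open>j\<close> of \<open>k\<close>
  is the state of the qubit at site \<open>j\<close>; bit value 0 has \<open>\<sigma>\<^sup>z = +1\<close>, bit value 1 has \<open>\<sigma>\<^sup>z = -1\<close>.
\<close>

definition hdim :: "nat \<Rightarrow> nat" where
  "hdim L = 2 ^ (2 * L)"

definition one_site_op :: "nat \<Rightarrow> nat \<Rightarrow> complex mat \<Rightarrow> complex mat" where
  "one_site_op L a A = Matrix.mat (hdim L) (hdim L) (\<lambda>(k, k').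
     if \<forall>j<2*L. j \<noteq> a \<longrightarrow> bit k j = bit k' j
     then A $$ (of_bool (bit k a), of_bool (bit k' a)) else 0)"

text \<open>
  The operator acting as \<open>G\<close> on the sites \<open>a\<close> (first tensor factor) and \<open>b\<close> (second tensor
  factor). The index \<open>2i + j\<close> for the basis vector \<open>e\<^sub>i \<otimes> e\<^sub>j\<close> is the one used by \<^const>\<open>kron\<close>.
\<close>

definition two_site_op :: "nat \<Rightarrow> nat \<Rightarrow> nat \<Rightarrow> complex mat \<Rightarrow> complex mat" where
  "two_site_op L a b G = Matrix.mat (hdim L) (hdim L) (\<lambda>(k, k').
     if \<forall>j<2*L. j \<noteq> a \<and> j \<noteq> b \<longrightarrow> bit k j = bit k' j
     then G $$ (2 * of_bool (bit k a) + of_bool (bit k b), 2 * of_bool (bit k' a) + of_bool (bit k' b))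
     else 0)"

definition pauli_z :: "complex mat" where
  "pauli_z = mat_of_rows_list 2 [[1, 0], [0, -1]]"

text \<open>The matrix \<open>e\<^bsup>i\<phi>\<sigma>\<^esup>\<close> with \<open>\<sigma> = \<sigma>\<^sup>z\<close>.\<close>

definition phase_z :: "real \<Rightarrow> complex mat" where
  "phase_z \<phi> = mat_of_rows_list 2 [[cis \<phi>, 0], [0, cis (- \<phi>)]]"

definition z_string :: "nat \<Rightarrow> nat set \<Rightarrow> complex mat" where
  "z_string L X = mat_list_prod (hdim L) (\<lambda>x. one_site_op L x pauli_z) (sorted_list_of_set X)"


section \<open>The random brickwork circuit\<close>

text \<open>
  Layers are numbered \<open>0, 1, 2, \<dots>\<close> in the order in which they act; time step \<open>n\<close> consists of
  the layers \<open>2n\<close> and \<open>2n + 1\<close>. The phase with label \<open>(n, x, c)\<close> belongs to layer \<open>n\<close>, to the gate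
  of unit cell \<open>x < L\<close>, and to its left (\<open>c = 0\<close>) or right (\<open>c = 1\<close>) site.
\<close>

type_synonym phase_label = "nat \<times> nat \<times> nat"

definition phase_labels :: "nat \<Rightarrow> nat \<Rightarrow> phase_label set" where
  "phase_labels L t = {..<2*t} \<times> {..<L} \<times> {..<2}"

definition phase_measure :: "nat \<Rightarrow> nat \<Rightarrow> (phase_label \<Rightarrow> real) measure" where
  "phase_measure L t = PiM (phase_labels L t) (\<lambda>_. uniform_measure lborel {-pi..pi})"

definition gate :: "complex mat \<Rightarrow> real \<Rightarrow> real \<Rightarrow> complex mat" where
  "gate U \<phi> \<phi>' = kron (phase_z \<phi>) (phase_z \<phi>') * U"

text \<open>Even layers act on the pairs \<open>(x + 1/2, x + 1)\<close>, odd layers on the pairs \<open>(x, x + 1/2)\<close>.\<close>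

definition gate_op :: "nat \<Rightarrow> complex mat \<Rightarrow> (phase_label \<Rightarrow> real) \<Rightarrow> nat \<Rightarrow> nat \<Rightarrow> complex mat" where
  "gate_op L U \<phi> n x =
     (if even n then two_site_op L (2*x + 1) ((2*x + 2) mod (2*L)) (gate U (\<phi> (n, x, 0)) (\<phi> (n, x, 1)))
      else two_site_op L (2*x) (2*x + 1) (gate U (\<phi> (n, x, 0)) (\<phi> (n, x, 1))))"

definition layer :: "nat \<Rightarrow> complex mat \<Rightarrow> (phase_label \<Rightarrow> real) \<Rightarrow> nat \<Rightarrow> complex mat" where
  "layer L U \<phi> n = mat_list_prod (hdim L) (gate_op L U \<phi> n) [0..<L]"

primrec circuit :: "nat \<Rightarrow> complex mat \<Rightarrow> (phase_label \<Rightarrow> real) \<Rightarrow> nat \<Rightarrow> complex mat" where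
  "circuit L U \<phi> 0 = 1\<^sub>m (hdim L)"
| "circuit L U \<phi> (Suc t) = layer L U \<phi> (2*t + 1) * layer L U \<phi> (2*t) * circuit L U \<phi> t"


section \<open>Conserved charges and symmetry sectors\<close>

definition conserved_charge :: "nat \<Rightarrow> complex mat \<Rightarrow> complex mat \<Rightarrow> bool" where
  "conserved_charge L U Q \<longleftrightarrow> mat_hermitian (hdim L) Q \<and>
     (\<forall>\<phi> t. Q * circuit L U \<phi> t = circuit L U \<phi> t * Q)"

text \<open>Multiples of the identity are always conserved and do not count as charges.\<close>

definition no_conserved_charges :: "nat \<Rightarrow> complex mat \<Rightarrow> bool" where
  "no_conserved_charges L U \<longleftrightarrow>
     (\<forall>Q. conserved_charge L U Q \<longrightarrow> (\<exists>c. Q = c \<cdot>\<^sub>m 1\<^sub>m (hdim L)))"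

text \<open>
  Sectors are joint eigenspaces of a maximal family of mutually commuting charges. If all
  charges commute with one another, the only such family is the set of all charges. A sector is
  invariant under the circuit, which in general does not act on it as a scalar.
\<close>

definition maximal_commuting_charges :: "nat \<Rightarrow> complex mat \<Rightarrow> complex mat set \<Rightarrow> bool" where
  "maximal_commuting_charges L U C \<longleftrightarrow>
     (\<forall>Q\<in>C. conserved_charge L U Q) \<and>
     (\<forall>Q\<in>C. \<forall>R\<in>C. Q * R = R * Q) \<and>
     (\<forall>R. conserved_charge L U R \<and> (\<forall>Q\<in>C. Q * R = R * Q) \<longrightarrow> R \<in> C)"

definition symmetry_sector :: "nat \<Rightarrow> complex mat \<Rightarrow> complex Matrix.vec set \<Rightarrow> bool" where
  "symmetry_sector L U V \<longleftrightarrow>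
     (\<exists>C q. maximal_commuting_charges L U C \<and>
            V = {v \<in> carrier_vec (hdim L). \<forall>Q\<in>C. Q *\<^sub>v v = q Q \<cdot>\<^sub>v v}) \<and>
     V \<noteq> {0\<^sub>v (hdim L)}"

lemma symmetry_sector_no_charges:
  assumes "no_conserved_charges L U"
  shows "symmetry_sector L U V \<longleftrightarrow> V = carrier_vec (hdim L)"
proof
  let ?N = "hdim L"
  have scal: "(c \<cdot>\<^sub>m 1\<^sub>m ?N) *\<^sub>v v = c \<cdot>\<^sub>v v" if "v \<in> carrier_vec ?N" for c :: complex and v
    using that by (intro eq_vecI) (auto simp: row_smult)
  {
    assume "symmetry_sector L U V"
    then obtain C q where C: "maximal_commuting_charges L U C"
      and V: "V = {v \<in> carrier_vec ?N. \<forall>Q\<in>C. Q *\<^sub>v v = q Q \<cdot>\<^sub>v v}" and V0: "V \<noteq> {0\<^sub>v ?N}"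
      unfolding symmetry_sector_def by blast
    have charge: "\<exists>c. Q = c \<cdot>\<^sub>m 1\<^sub>m ?N" if "Q \<in> C" for Q
      using C assms that unfolding maximal_commuting_charges_def no_conserved_charges_def by blast
    have "0\<^sub>v ?N \<in> V"
    proof -
      have "Q *\<^sub>v 0\<^sub>v ?N = q Q \<cdot>\<^sub>v 0\<^sub>v ?N" if Q: "Q \<in> C" for Q
      proof -
        obtain c where c: "Q = c \<cdot>\<^sub>m 1\<^sub>m ?N" using charge[OF Q] by blast
        have z: "a \<cdot>\<^sub>v 0\<^sub>v ?N = 0\<^sub>v ?N" for a :: complex by (intro eq_vecI) auto
        show ?thesis unfolding c by (simp add: scal z)
      qed
      then show ?thesis unfolding V by simp
    qed
    then obtain v where v: "v \<in> V" "v \<noteq> 0\<^sub>v ?N" using V0 by blast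
    then have vc: "v \<in> carrier_vec ?N" using V by blast
    then obtain i where i: "i < ?N" "v $ i \<noteq> 0"
      using v(2) by (metis carrier_vecD eq_vecI index_zero_vec)
    have "Q = q Q \<cdot>\<^sub>m 1\<^sub>m ?N" if Q: "Q \<in> C" for Q
    proof -
      obtain c where c: "Q = c \<cdot>\<^sub>m 1\<^sub>m ?N" using charge[OF Q] by blast
      have "c \<cdot>\<^sub>v v = q Q \<cdot>\<^sub>v v" using scal[OF vc, of c] v(1) Q c V by auto
      then have "(c \<cdot>\<^sub>v v) $ i = (q Q \<cdot>\<^sub>v v) $ i" by simp
      then have "c = q Q" using i vc by simp
      then show ?thesis using c by simp
    qed
    then have "Q *\<^sub>v w = q Q \<cdot>\<^sub>v w" if "Q \<in> C" "w \<in> carrier_vec ?N" for Q w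
      using scal[OF that(2), of "q Q"] that(1) by metis
    then show "V = carrier_vec ?N" unfolding V by blast
  next
    assume V: "V = carrier_vec ?N"
    define q where "q Q = (SOME c. Q = c \<cdot>\<^sub>m 1\<^sub>m ?N)" for Q :: "complex mat"
    have q: "Q = q Q \<cdot>\<^sub>m 1\<^sub>m ?N" if "conserved_charge L U Q" for Q
    proof -
      have "\<exists>c. Q = c \<cdot>\<^sub>m 1\<^sub>m ?N"
        using assms that unfolding no_conserved_charges_def by blast
      then show ?thesis unfolding q_def by (rule someI_ex)
    qed
    have comm: "Q * R = R * Q" if "conserved_charge L U Q" "conserved_charge L U R" for Q R
    proof -
      have R: "R \<in> carrier_mat ?N ?N" using that unfolding conserved_charge_def mat_hermitian_def by blast
      have "(q Q \<cdot>\<^sub>m 1\<^sub>m ?N) * R = R * (q Q \<cdot>\<^sub>m 1\<^sub>m ?N)"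
        using R by (simp add: mult_smult_distrib[of _ ?N ?N _ ?N] mult_smult_assoc_mat[of _ ?N ?N _ ?N])
      then show ?thesis using q[OF that(1)] by metis
    qed
    have "maximal_commuting_charges L U (Collect (conserved_charge L U))"
      unfolding maximal_commuting_charges_def using comm by blast
    moreover have "carrier_vec ?N = {v \<in> carrier_vec ?N. \<forall>Q\<in>Collect (conserved_charge L U). Q *\<^sub>v v = q Q \<cdot>\<^sub>v v}"
    proof -
      have "Q *\<^sub>v v = q Q \<cdot>\<^sub>v v" if "conserved_charge L U Q" "v \<in> carrier_vec ?N" for Q v
        using arg_cong[OF q[OF that(1)], of "\<lambda>A. A *\<^sub>v v"] scal[OF that(2)] by simp
      then show ?thesis by blast
    qed
    moreover have "carrier_vec ?N \<noteq> {0\<^sub>v ?N :: complex Matrix.vec}"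
    proof -
      have "unit_vec ?N 0 \<noteq> (0\<^sub>v ?N :: complex Matrix.vec)"
        by (simp add: hdim_def)
      then show ?thesis by (metis singletonD unit_vec_carrier)
    qed
    ultimately show "symmetry_sector L U V" unfolding symmetry_sector_def V by blast
  }
qed


section \<open>Correlation functions and the spectral form factor\<close>

definition correlation :: "nat \<Rightarrow> complex mat \<Rightarrow> nat \<Rightarrow> nat set \<Rightarrow> nat set \<Rightarrow> complex" where
  "correlation L U t X Y = (\<integral>\<phi>. mat_trace (z_string L X * (mat_adjoint (circuit L U \<phi> t) *
       z_string L Y * circuit L U \<phi> t)) / 2 ^ (2*L) \<partial>phase_measure L t)"

definition Kg :: "nat \<Rightarrow> complex mat \<Rightarrow> complex Matrix.vec set \<Rightarrow> nat \<Rightarrow> real" where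
  "Kg L U V t = (\<integral>\<phi>. (cmod (sector_trace (hdim L) V (circuit L U \<phi> t)))\<^sup>2 \<partial>phase_measure L t)"

definition Kg_part :: "nat \<Rightarrow> complex mat \<Rightarrow> nat \<Rightarrow> nat \<Rightarrow> complex" where
  "Kg_part L U m t = (\<Sum>X | X \<subseteq> {..<2*L} \<and> card X = m. correlation L U t X X)"

end

theory Submission
  imports Defs
begin

text \<open>
  The phases of the last layer multiply the circuit \<open>C\<close> from the left by a diagonal matrix whose
  \<open>k\<close>-th entry is a product of \<open>e\<^bsup>\<plusminus>i\<phi>\<^esup>\<close> over the sites, the sign being that of
  \<open>\<sigma>\<^sup>z\<close> in the basis state \<open>k\<close>. Two distinct basis states \<open>k \<noteq> l\<close> differ at some site, whose phase then
  enters \<open>C\<^bsub>kk\<^esub>\<close> times the conjugate of \<open>C\<^bsub>ll\<^esub>\<close> as \<open>e\<^bsup>\<plusminus>2i\<phi>\<^esup>\<close> and averages to zero. Hence the spectral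
  form factor is the sum over \<open>k\<close> of the averages of \<open>|C\<^bsub>kk\<^esub>|\<^sup>2\<close>. The autocorrelations of the
  \<open>\<sigma>\<^sup>z\<close> strings sum to the same quantity, because the strings are the characters of the group of spin
  flips: by their orthogonality only the diagonal terms of
  \<open>\<Sum>\<^bsub>k,l\<^esub> \<chi>\<^bsub>X\<^esub>(k) \<chi>\<^bsub>X\<^esub>(l) |C\<^bsub>lk\<^esub>|\<^sup>2\<close> survive the sum over \<open>X\<close>.
\<close>

section \<open>Entrywise matrix algebra\<close>

lemma mult_mat_entry:
  assumes "A \<in> carrier_mat n m" "B \<in> carrier_mat m p" "i < n" "j < p"
  shows "(A * B) $$ (i, j) = (\<Sum>l<m. A $$ (i, l) * B $$ (l, j))"
  using assms by (auto simp: scalar_prod_def atLeast0LessThan intro!: sum.cong)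

section \<open>Adjoints and unitary matrices\<close>

lemma mat_adjoint_dim [simp]:
  "dim_row (mat_adjoint A) = dim_col A" "dim_col (mat_adjoint A) = dim_row A"
  by (auto simp: mat_adjoint_def)

lemma mat_adjoint_carrier [simp]:
  "A \<in> carrier_mat n m \<Longrightarrow> mat_adjoint A \<in> carrier_mat m n"
  by (intro carrier_matI) auto

lemma mat_adjoint_entry [simp]:
  "i < dim_col A \<Longrightarrow> j < dim_row A \<Longrightarrow> mat_adjoint (A :: complex mat) $$ (i, j) = cnj (A $$ (j, i))"
  by (auto simp: mat_adjoint_def mat_of_rows_index)

text \<open>Orthonormality of columns is what the local operators satisfy term by term, so unitarity
  of gates and two-site operators becomes a statement about finite sums.\<close>

lemma mat_unitary_iff_entries:
  "mat_unitary n A \<longleftrightarrow> A \<in> carrier_mat n n \<and>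
     (\<forall>i<n. \<forall>j<n. (\<Sum>l<n. cnj (A $$ (l, i)) * A $$ (l, j)) = of_bool (i = j))"
proof (cases "A \<in> carrier_mat n n")
  case True
  have "(mat_adjoint A * A) $$ (i, j) = (\<Sum>l<n. cnj (A $$ (l, i)) * A $$ (l, j))"
    if "i < n" "j < n" for i j
    using True that by (subst mult_mat_entry[where n=n and m=n and p=n]) auto
  moreover have "mat_adjoint A * A = 1\<^sub>m n \<longleftrightarrow>
      (\<forall>i<n. \<forall>j<n. (mat_adjoint A * A) $$ (i, j) = of_bool (i = j))"
    using True by (auto simp: mat_eq_iff)
  ultimately show ?thesis
    using True by (simp add: mat_unitary_def)
qed (simp add: mat_unitary_def)

lemma mat_unitary_one: "mat_unitary n (1\<^sub>m n)"
proof -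
  have "(\<Sum>l<n. cnj (1\<^sub>m n $$ (l, i)) * 1\<^sub>m n $$ (l, j)) = of_bool (i = j)"
    if ij: "i < n" "j < n" for i j
  proof -
    have "(\<Sum>l<n. cnj (1\<^sub>m n $$ (l, i)) * 1\<^sub>m n $$ (l, j)) =
          (\<Sum>l<n. if l = i then of_bool (i = j) else (0::complex))"
      using ij by (intro sum.cong) auto
    then show ?thesis using ij by simp
  qed
  then show ?thesis by (auto simp: mat_unitary_iff_entries)
qed

lemma mat_unitary_mult:
  assumes A: "mat_unitary n A" and B: "mat_unitary n B"
  shows "mat_unitary n (A * B)"
proof -
  have [simp]: "A \<in> carrier_mat n n" "B \<in> carrier_mat n n"
    using A B by (auto simp: mat_unitary_def)
  have adj: "mat_adjoint (A * B) = mat_adjoint B * mat_adjoint A"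
  proof (rule eq_matI)
    fix i j assume "i < dim_row (mat_adjoint B * mat_adjoint A)" "j < dim_col (mat_adjoint B * mat_adjoint A)"
    then have ij: "i < n" "j < n"
      using carrier_matD[of A n n] carrier_matD[of B n n] by auto
    have "mat_adjoint (A * B) $$ (i, j) = cnj ((A * B) $$ (j, i))"
      using ij carrier_matD[of A n n] carrier_matD[of B n n] by (intro mat_adjoint_entry) auto
    also have "\<dots> = (\<Sum>l<n. mat_adjoint B $$ (i, l) * mat_adjoint A $$ (l, j))"
      using ij carrier_matD[of A n n] carrier_matD[of B n n]
      by (subst mult_mat_entry[where n=n and m=n and p=n]) (auto simp: mult.commute intro!: sum.cong)
    also have "\<dots> = (mat_adjoint B * mat_adjoint A) $$ (i, j)"
      using ij by (subst mult_mat_entry[where n=n and m=n and p=n]) auto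
    finally show "mat_adjoint (A * B) $$ (i, j) = (mat_adjoint B * mat_adjoint A) $$ (i, j)" .
  qed auto
  have "mat_adjoint (A * B) * (A * B) = mat_adjoint B * (mat_adjoint A * A) * B"
    unfolding adj by (simp add: assoc_mult_mat[of _ n n _ n _ n] mult_carrier_mat[of _ n n _ n])
  also have "\<dots> = 1\<^sub>m n"
    using A B by (simp add: mat_unitary_def right_mult_one_mat[of _ n n])
  finally show ?thesis
    by (simp add: mat_unitary_def mult_carrier_mat[of _ n n _ n])
qed

section \<open>Ordered products\<close>

lemma mat_list_prod_simps [simp]:
  "mat_list_prod N f [] = 1\<^sub>m N"
  "mat_list_prod N f (x # xs) = f x * mat_list_prod N f xs"
  by (simp_all add: mat_list_prod_def)

lemma mat_list_prod_carrier:
  assumes "\<And>x. x \<in> set xs \<Longrightarrow> f x \<in> carrier_mat N N"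
  shows "mat_list_prod N f xs \<in> carrier_mat N N"
  using assms by (induction xs) (auto intro!: mult_carrier_mat)

lemma mat_unitary_list_prod:
  assumes "\<And>x. x \<in> set xs \<Longrightarrow> mat_unitary N (f x)"
  shows "mat_unitary N (mat_list_prod N f xs)"
  using assms by (induction xs) (auto intro!: mat_unitary_mult mat_unitary_one)

lemma mat_list_prod_cong:
  "(\<And>x. x \<in> set xs \<Longrightarrow> f x = g x) \<Longrightarrow> mat_list_prod N f xs = mat_list_prod N g xs"
  by (induction xs) auto

text \<open>
  \<open>d\<close> is the diagonal of a matrix that multiplies the factor \<open>x\<^sub>0\<close> from the left; the
  last assumption says that it commutes with the other factors, so it can be pulled to the front.
\<close>

lemma mat_list_prod_row_scale:
  assumes "distinct xs"
    and "\<And>x. x \<in> set xs \<Longrightarrow> f x \<in> carrier_mat N N" "\<And>x. x \<in> set xs \<Longrightarrow> g x \<in> carrier_mat N N"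
    and "\<And>x. x \<in> set xs \<Longrightarrow> x \<noteq> x\<^sub>0 \<Longrightarrow> f x = g x"
    and "\<And>k l. k < N \<Longrightarrow> l < N \<Longrightarrow> f x\<^sub>0 $$ (k, l) = d k * g x\<^sub>0 $$ (k, l)"
    and "\<And>x k l. x \<in> set xs \<Longrightarrow> x \<noteq> x\<^sub>0 \<Longrightarrow> k < N \<Longrightarrow> l < N \<Longrightarrow> g x $$ (k, l) \<noteq> 0 \<Longrightarrow> d l = d k"
    and "x\<^sub>0 \<in> set xs" "k < N" "l < N"
  shows "mat_list_prod N f xs $$ (k, l) = d k * mat_list_prod N g xs $$ (k, l)"
  using assms
proof (induction xs arbitrary: k l)
  case (Cons x xs)
  have f: "f x \<in> carrier_mat N N" "mat_list_prod N f xs \<in> carrier_mat N N"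
    using Cons.prems(2) by (auto intro!: mat_list_prod_carrier)
  have g: "g x \<in> carrier_mat N N" "mat_list_prod N g xs \<in> carrier_mat N N"
    using Cons.prems(3) by (auto intro!: mat_list_prod_carrier)
  note kl = \<open>k < N\<close> \<open>l < N\<close>
  have "(\<Sum>m<N. f x $$ (k, m) * mat_list_prod N f xs $$ (m, l)) =
        (\<Sum>m<N. d k * (g x $$ (k, m) * mat_list_prod N g xs $$ (m, l)))"
  proof (cases "x = x\<^sub>0")
    case True
    then have "mat_list_prod N f xs = mat_list_prod N g xs"
      using Cons.prems(1,4) by (intro mat_list_prod_cong) auto
    then show ?thesis
      using True Cons.prems(5) kl by (intro sum.cong) auto
  next
    case False
    have IH: "mat_list_prod N f xs $$ (m, l) = d m * mat_list_prod N g xs $$ (m, l)" if "m < N" for m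
    proof (rule Cons.IH)
      show "d l = d k" if "x \<in> set xs" "x \<noteq> x\<^sub>0" "k < N" "l < N" "g x $$ (k, l) \<noteq> 0" for x k l
        using that by (intro Cons.prems(6)[of x]) auto
    qed (use False Cons.prems that in auto)
    have "f x = g x" using False Cons.prems(4) by simp
    \<comment> \<open>Commutation with the diagonal: every intermediate index \<open>m\<close> that
      contributes has \<open>d m = d k\<close>, so the factor from the induction hypothesis moves
      past \<open>g x\<close>.\<close>
    moreover have "g x $$ (k, m) = 0 \<or> d m = d k" if "m < N" for m
      using Cons.prems(6)[of x k m] False kl that by auto
    ultimately show ?thesis
      using IH by (intro sum.cong) auto
  qed
  then show ?case
    using f g kl
    by (simp add: mult_mat_entry[of _ N N _ N] sum_distrib_left del: index_mult_mat)
qed simp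

section \<open>Local operators\<close>

lemma bit_eq_below_iff:
  fixes k l :: nat
  assumes "k < 2 ^ n" "l < 2 ^ n"
  shows "k = l \<longleftrightarrow> (\<forall>j<n. bit k j = bit l j)"
proof
  assume *: "\<forall>j<n. bit k j = bit l j"
  have "take_bit n k = take_bit n l"
    using * by (intro bit_eqI) (auto simp: bit_take_bit_iff)
  then show "k = l" using assms by (simp add: take_bit_nat_eq_self)
qed simp

text \<open>Only the bits at \<open>a\<close> and \<open>b\<close> are free in the index set, and
  reading them as a two-digit binary number enumerates it by \<open>{..<4}\<close>. This collapses a
  sum over the whole Hilbert space to one over two qubits.\<close>

lemma sum_two_bits:
  fixes h :: "nat \<Rightarrow> 'a :: comm_monoid_add" and k :: nat
  assumes ab: "a \<noteq> b" "a < n" "b < n"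
  shows "(\<Sum>l::nat | l < 2 ^ n \<and> (\<forall>j<n. j \<noteq> a \<and> j \<noteq> b \<longrightarrow> bit l j = bit k j).
            h (2 * of_bool (bit l a) + of_bool (bit l b))) = (\<Sum>i<4. h i)"
proof (rule sum.reindex_bij_betw)
  let ?S = "{l::nat. l < 2 ^ n \<and> (\<forall>j<n. j \<noteq> a \<and> j \<noteq> b \<longrightarrow> bit l j = bit k j)}"
  let ?f = "\<lambda>l::nat. 2 * of_bool (bit l a) + of_bool (bit l b) :: nat"
  show "bij_betw ?f ?S {..<4}"
  proof (rule bij_betwI')
    fix l m :: nat assume l: "l \<in> ?S" and m: "m \<in> ?S"
    show "(?f l = ?f m) = (l = m)"
    proof
      assume "?f l = ?f m"
      then have "bit l a = bit m a" "bit l b = bit m b"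
        by (auto split: if_splits simp: of_bool_def)
      then have "bit l j = bit m j" if "j < n" for j
        using l m that by (cases "j = a \<or> j = b") auto
      then show "l = m" using l m bit_eq_below_iff[of l n m] by auto
    qed simp
  next
    fix l assume "l \<in> ?S" then show "?f l \<in> {..<4}" by auto
  next
    fix i :: nat assume i: "i \<in> {..<4}"
    \<comment> \<open>Preimage of \<open>i\<close>: overwrite bits \<open>a\<close> and
      \<open>b\<close> of \<open>k\<close> with the binary digits of \<open>i\<close>. Truncation by
      \<open>take_bit n\<close> is applied afterwards because \<open>k\<close> itself need not be
      below \<open>2 ^ n\<close>.\<close>
    define l\<^sub>1 where "l\<^sub>1 = (if i \<ge> 2 then set_bit a k else unset_bit a k)"
    define l\<^sub>2 where "l\<^sub>2 = (if odd i then set_bit b l\<^sub>1 else unset_bit b l\<^sub>1)"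
    have bits: "bit (take_bit n l\<^sub>2) j = (if j = b then odd i else if j = a then i \<ge> 2 else bit k j)"
      if "j < n" for j
      using that by (auto simp: l\<^sub>1_def l\<^sub>2_def bit_simps)
    have "take_bit n l\<^sub>2 \<in> ?S"
      using bits by simp
    moreover have "i = ?f (take_bit n l\<^sub>2)"
    proof -
      have "i = 0 \<or> i = 1 \<or> i = 2 \<or> i = 3" using i by auto
      then show ?thesis using bits[of a] bits[of b] ab by auto
    qed
    ultimately show "\<exists>l\<in>?S. i = ?f l" by blast
  qed
qed

lemma two_site_op_carrier [simp]: "two_site_op L a b G \<in> carrier_mat (hdim L) (hdim L)"
  by (simp add: two_site_op_def)

lemma two_site_op_entry:
  assumes "k < hdim L" "k' < hdim L"
  shows "two_site_op L a b G $$ (k, k') =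
    (if \<forall>j<2*L. j \<noteq> a \<and> j \<noteq> b \<longrightarrow> bit k j = bit k' j
     then G $$ (2 * of_bool (bit k a) + of_bool (bit k b), 2 * of_bool (bit k' a) + of_bool (bit k' b))
     else 0)"
  using assms by (simp add: two_site_op_def)

text \<open>Columns that disagree away from \<open>a\<close> and \<open>b\<close> have disjoint
  supports. For columns that agree there, the inner product is that of two columns of
  \<open>G\<close>.\<close>

lemma mat_unitary_two_site_op:
  assumes G: "mat_unitary 4 G" and ab: "a \<noteq> b" "a < 2 * L" "b < 2 * L"
  shows "mat_unitary (hdim L) (two_site_op L a b G)"
proof -
  let ?T = "two_site_op L a b G" and ?N = "hdim L"
  define agree where "agree k l \<longleftrightarrow> (\<forall>j<2*L. j \<noteq> a \<and> j \<noteq> b \<longrightarrow> bit k j = bit l j)" for k l :: nat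
  define f where "f l = 2 * of_bool (bit l a) + (of_bool (bit l b) :: nat)" for l :: nat
  have f4: "f l < 4" for l
    unfolding f_def by auto
  have G_cols: "(\<Sum>l<4. cnj (G $$ (l, i)) * G $$ (l, j)) = of_bool (i = j)" if "i < 4" "j < 4" for i j
    using G that by (simp add: mat_unitary_iff_entries)
  have T: "?T $$ (k, l) = (if agree k l then G $$ (f k, f l) else 0)" if "k < ?N" "l < ?N" for k l
    using two_site_op_entry[OF that] unfolding agree_def f_def .
  have f_inj: "f k = f k' \<longleftrightarrow> k = k'" if k: "k < ?N" "k' < ?N" and "agree k k'" for k k'
  proof
    assume "f k = f k'"
    then have "bit k a = bit k' a" "bit k b = bit k' b"
      unfolding f_def by (auto split: if_splits simp: of_bool_def)
    then have "bit k j = bit k' j" if "j < 2 * L" for j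
      using \<open>agree k k'\<close> that unfolding agree_def by (cases "j = a \<or> j = b") auto
    then show "k = k'"
      using k bit_eq_below_iff[of k "2*L" k'] by (auto simp: hdim_def)
  qed simp
  have "(\<Sum>l<?N. cnj (?T $$ (l, k)) * ?T $$ (l, k')) = of_bool (k = k')"
    if k: "k < ?N" "k' < ?N" for k k'
  proof (cases "agree k k'")
    case True
    \<comment> \<open>\<open>agree\<close> is an equivalence relation, so the supports of the two
      columns coincide and one condition suffices.\<close>
    have "agree l k' \<longleftrightarrow> agree l k" for l
      using True unfolding agree_def by metis
    then have "(\<Sum>l<?N. cnj (?T $$ (l, k)) * ?T $$ (l, k')) =
          (\<Sum>l<?N. if agree l k then cnj (G $$ (f l, f k)) * G $$ (f l, f k') else 0)"
      using k by (intro sum.cong) (auto simp: T)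
    also have "\<dots> = (\<Sum>l | l \<in> {..<?N} \<and> agree l k. cnj (G $$ (f l, f k)) * G $$ (f l, f k'))"
      by (rule sum.inter_filter[symmetric]) simp
    also have "\<dots> = (\<Sum>i<4. cnj (G $$ (i, f k)) * G $$ (i, f k'))"
      using sum_two_bits[OF ab, of "\<lambda>i. cnj (G $$ (i, f k)) * G $$ (i, f k')" k]
      unfolding agree_def f_def hdim_def lessThan_iff .
    also have "\<dots> = of_bool (f k = f k')"
      using f4 by (intro G_cols)
    finally show ?thesis using f_inj[OF k True] by simp
  next
    case False
    then have "\<not> (agree l k \<and> agree l k')" for l
      unfolding agree_def by metis
    then have "(\<Sum>l<?N. cnj (?T $$ (l, k)) * ?T $$ (l, k')) = 0"
      using k by (intro sum.neutral ballI) (auto simp: T)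
    moreover have "k \<noteq> k'" using False by (auto simp: agree_def)
    ultimately show ?thesis by simp
  qed
  then show ?thesis by (simp add: mat_unitary_iff_entries)
qed

text \<open>The \<open>k\<close>-th diagonal entry of \<open>e\<^bsup>i y \<sigma>\<^esup>\<close> acting on site \<open>j\<close>, with \<open>\<sigma> = \<sigma>\<^sup>z\<close>.\<close>

definition site_phase :: "nat \<Rightarrow> real \<Rightarrow> nat \<Rightarrow> complex" where
  "site_phase j y k = cis (if bit k j then - y else y)"

section \<open>The random phases of a gate\<close>

lemma dim_kron [simp]:
  "dim_row (kron A B) = dim_row A * dim_row B" "dim_col (kron A B) = dim_col A * dim_col B"
  by (simp_all add: kron_def)

lemma dim_phase_z [simp]: "dim_row (phase_z \<phi>) = 2" "dim_col (phase_z \<phi>) = 2"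
  by (simp_all add: phase_z_def mat_of_rows_list_def)

lemma phase_z_entry:
  "phase_z \<phi> $$ (of_bool p, of_bool q) = (if p = q then cis (if p then - \<phi> else \<phi>) else 0)"
  by (cases p; cases q) (simp_all add: phase_z_def mat_of_rows_list_def)

lemma kron_entry_bits:
  assumes "dim_row A = 2" "dim_col A = 2" "dim_row B = 2" "dim_col B = 2"
  shows "kron A B $$ (2 * of_bool p + of_bool q, 2 * of_bool p' + of_bool q') =
    A $$ (of_bool p, of_bool p') * B $$ (of_bool q, of_bool q')"
proof -
  have "2 * of_bool x + of_bool y < (4::nat)" "(2 * of_bool x + of_bool y) div 2 = (of_bool x :: nat)"
    "(2 * of_bool x + of_bool y) mod 2 = (of_bool y :: nat)" for x y
    by (cases x; cases y; simp)+
  then show ?thesis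
    using assms by (simp add: kron_def)
qed

lemma two_bits_cases:
  assumes "l < (4::nat)"
  obtains p q where "l = 2 * of_bool p + of_bool q"
proof
  show "l = 2 * of_bool (l \<ge> 2) + of_bool (odd l)"
    using assms by (auto elim!: oddE evenE)
qed

lemma gate_carrier: "U \<in> carrier_mat 4 4 \<Longrightarrow> gate U \<phi> \<phi>' \<in> carrier_mat 4 4"
  by (rule carrier_matI) (simp_all add: gate_def)

text \<open>The Kronecker product of the phase matrices is diagonal, so a single term of the matrix
  product survives.\<close>

lemma gate_entry:
  assumes U: "U \<in> carrier_mat 4 4" and j: "j < 4"
  shows "gate U \<phi> \<phi>' $$ (2 * of_bool p + of_bool q, j) =
    cis (if p then - \<phi> else \<phi>) * cis (if q then - \<phi>' else \<phi>') * U $$ (2 * of_bool p + of_bool q, j)"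
proof -
  let ?i = "2 * of_bool p + of_bool q :: nat" and ?K = "kron (phase_z \<phi>) (phase_z \<phi>')"
  have i: "?i < 4" by (cases p; cases q) simp_all
  have K: "?K \<in> carrier_mat 4 4"
    by (rule carrier_matI) simp_all
  have entry: "?K $$ (?i, l) = (if l = ?i then cis (if p then - \<phi> else \<phi>) * cis (if q then - \<phi>' else \<phi>') else 0)"
    if l: "l < 4" for l
  proof -
    obtain p' q' where l_eq: "l = 2 * of_bool p' + of_bool q'"
      using two_bits_cases[OF l] .
    show ?thesis
      unfolding l_eq by (cases p; cases q; cases p'; cases q') (simp_all only: kron_entry_bits dim_phase_z phase_z_entry, simp_all)
  qed
  have "gate U \<phi> \<phi>' $$ (?i, j) = (\<Sum>l<4. ?K $$ (?i, l) * U $$ (l, j))"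
    unfolding gate_def using K U i j by (rule mult_mat_entry)
  also have "\<dots> = (\<Sum>l<4. if l = ?i then cis (if p then - \<phi> else \<phi>) * cis (if q then - \<phi>' else \<phi>') * U $$ (l, j) else 0)"
    by (intro sum.cong) (auto simp: entry)
  finally show ?thesis using i by simp
qed

text \<open>The phases depend on the row only and have modulus one, so they cancel in every term of
  an inner product of columns.\<close>

lemma mat_unitary_gate:
  assumes U: "mat_unitary 4 U"
  shows "mat_unitary 4 (gate U \<phi> \<phi>')"
proof -
  have Uc: "U \<in> carrier_mat 4 4" using U by (simp add: mat_unitary_def)
  have "cnj (gate U \<phi> \<phi>' $$ (l, i)) * gate U \<phi> \<phi>' $$ (l, j) = cnj (U $$ (l, i)) * U $$ (l, j)"
    if l: "l < 4" and "i < 4" "j < 4" for l i j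
  proof -
    obtain p q where l_eq: "l = 2 * of_bool p + of_bool q"
      using two_bits_cases[OF l] .
    have unit: "cnj (cis x * cis y * u) * (cis x * cis y * v) = cnj u * v" for x y u v
    proof -
      have "cnj (cis x * cis y * u) * (cis x * cis y * v) =
            (cnj (cis x) * cis x) * (cnj (cis y) * cis y) * (cnj u * v)"
        by (simp add: mult_ac)
      then show ?thesis by (simp add: cis_cnj cis_mult)
    qed
    show ?thesis
      unfolding l_eq using that by (simp only: gate_entry[OF Uc] unit)
  qed
  then show ?thesis
    using U gate_carrier[OF Uc] by (simp add: mat_unitary_iff_entries)
qed

text \<open>Separates all randomness from the fixed matrix \<open>U\<close>; measurability and the
  effect of a single phase are both read off from this factorisation.\<close>

lemma two_site_gate_entry:
  assumes "U \<in> carrier_mat 4 4" "k < hdim L" "k' < hdim L"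
  shows "two_site_op L a b (gate U \<phi> \<phi>') $$ (k, k') =
    site_phase a \<phi> k * site_phase b \<phi>' k * two_site_op L a b U $$ (k, k')"
proof -
  have lt: "2 * of_bool (bit k' a) + of_bool (bit k' b) < (4::nat)" by auto
  show ?thesis
  proof (cases "\<forall>j<2*L. j \<noteq> a \<and> j \<noteq> b \<longrightarrow> bit k j = bit k' j")
    case True
    show ?thesis
      unfolding two_site_op_entry[OF assms(2,3)] if_P[OF True] gate_entry[OF assms(1) lt] site_phase_def
      by (rule refl)
  next
    case False
    show ?thesis
      unfolding two_site_op_entry[OF assms(2,3)] if_not_P[OF False] by simp
  qed
qed

section \<open>Layers and circuits\<close>

text \<open>Together with \<open>right_site\<close>, this lets even and odd layers be treated by one
  formula.\<close>

definition left_site :: "nat \<Rightarrow> nat \<Rightarrow> nat" where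
  "left_site n x = (if even n then 2 * x + 1 else 2 * x)"

definition right_site :: "nat \<Rightarrow> nat \<Rightarrow> nat \<Rightarrow> nat" where
  "right_site L n x = (if even n then (2 * x + 2) mod (2 * L) else 2 * x + 1)"

lemma gate_op_eq:
  "gate_op L U \<phi> n x =
    two_site_op L (left_site n x) (right_site L n x) (gate U (\<phi> (n, x, 0)) (\<phi> (n, x, 1)))"
  by (simp add: gate_op_def left_site_def right_site_def)

lemma gate_op_carrier [simp]: "gate_op L U \<phi> n x \<in> carrier_mat (hdim L) (hdim L)"
  by (simp add: gate_op_eq)

lemma layer_carrier [simp]: "layer L U \<phi> n \<in> carrier_mat (hdim L) (hdim L)"
  by (simp add: layer_def mat_list_prod_carrier)

lemma circuit_carrier [simp]: "circuit L U \<phi> s \<in> carrier_mat (hdim L) (hdim L)"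
  by (induction s) (auto intro!: mult_carrier_mat[of _ "hdim L" "hdim L" _ "hdim L"])

lemma sites_of_gate:
  assumes "x < L"
  shows "left_site n x \<noteq> right_site L n x" "left_site n x < 2 * L" "right_site L n x < 2 * L"
proof -
  \<comment> \<open>Reduction modulo the even number \<open>2 * L\<close> preserves parity, so the
    periodic wrap-around cannot make the two sites of a gate coincide, even for
    \<open>L = 1\<close>.\<close>
  have "even ((2 * x + 2) mod (2 * L))"
    by (simp add: even_mod_2_iff dvd_mod)
  moreover have "odd (2 * x + 1)" by simp
  ultimately have "2 * x + 1 \<noteq> (2 * x + 2) mod (2 * L)" by metis
  then show "left_site n x \<noteq> right_site L n x"
    by (simp add: left_site_def right_site_def)
qed (use assms in \<open>auto simp: left_site_def right_site_def\<close>)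

lemma mat_unitary_circuit:
  assumes U: "mat_unitary 4 U"
  shows "mat_unitary (hdim L) (circuit L U \<phi> s)"
proof (induction s)
  case (Suc s)
  have "mat_unitary (hdim L) (layer L U \<phi> n)" for n
    unfolding layer_def gate_op_eq
    using sites_of_gate U by (intro mat_unitary_list_prod mat_unitary_two_site_op mat_unitary_gate) auto
  with Suc show ?case by (auto intro!: mat_unitary_mult)
qed (simp add: mat_unitary_one)

lemma layer_cong:
  "(\<And>x c. \<phi> (n, x, c) = \<psi> (n, x, c)) \<Longrightarrow> layer L U \<phi> n = layer L U \<psi> n"
  unfolding layer_def gate_op_eq by (intro mat_list_prod_cong) simp

text \<open>Causality: the first \<open>s\<close> time steps consist of the layers below
  \<open>2 * s\<close>.\<close>

lemma circuit_cong:
  assumes "\<And>n x c. n < 2 * s \<Longrightarrow> \<phi> (n, x, c) = \<psi> (n, x, c)"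
  shows "circuit L U \<phi> s = circuit L U \<psi> s"
  using assms
proof (induction s)
  case (Suc s)
  have "layer L U \<phi> n = layer L U \<psi> n" if "n < 2 * Suc s" for n
    using Suc.prems[OF that] by (rule layer_cong)
  then show ?case using Suc by simp
qed simp

text \<open>
  The phases of the last layer act after all gates, so each of them multiplies the circuit by a
  diagonal matrix from the left.
\<close>

lemma circuit_last_phase:
  fixes \<phi> :: "phase_label \<Rightarrow> real" and s :: nat
  assumes U: "U \<in> carrier_mat 4 4" and x: "x < L" and c: "c < 2"
    and kl: "k < hdim L" "l < hdim L"
  defines "p \<equiv> (2 * s + 1, x, c)"
  shows "circuit L U (\<phi>(p := y)) (Suc s) $$ (k, l) =
    site_phase (2 * x + c) y k * circuit L U (\<phi>(p := 0)) (Suc s) $$ (k, l)"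
proof -
  let ?N = "hdim L" and ?d = "site_phase (2 * x + c) y"
  let ?F = "\<lambda>y. layer L U (\<phi>(p := y)) (2 * s + 1)"
  have sites: "left_site (2 * s + 1) x = 2 * x" "right_site L (2 * s + 1) x = 2 * x + 1" for x
    by (simp_all add: left_site_def right_site_def)
  have "c = 0 \<or> c = 1" using c by auto
  define R where "R = layer L U \<phi> (2 * s) * circuit L U \<phi> s"
  have R: "R \<in> carrier_mat ?N ?N"
    unfolding R_def by (intro mult_carrier_mat[of _ ?N ?N _ ?N]) auto
  \<comment> \<open>The label \<open>p\<close> lies in the final layer, so everything earlier is the
    same matrix \<open>R\<close> for all values \<open>z\<close>.\<close>
  have split: "circuit L U (\<phi>(p := z)) (Suc s) = ?F z * R" for z
  proof -
    have "layer L U (\<phi>(p := z)) (2 * s) = layer L U \<phi> (2 * s)"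
      by (rule layer_cong) (simp add: p_def)
    moreover have "circuit L U (\<phi>(p := z)) s = circuit L U \<phi> s"
      by (rule circuit_cong) (auto simp: p_def)
    ultimately show ?thesis
      by (simp add: R_def assoc_mult_mat[of _ ?N ?N _ ?N _ ?N])
  qed
  have layer: "?F y $$ (k, m) = ?d k * ?F 0 $$ (k, m)" if "m < ?N" for m
    unfolding layer_def
  proof (rule mat_list_prod_row_scale[where x\<^sub>0 = x])
    fix k l assume kl: "k < ?N" "l < ?N"
    then show "gate_op L U (\<phi>(p := y)) (2 * s + 1) x $$ (k, l) =
        ?d k * gate_op L U (\<phi>(p := 0)) (2 * s + 1) x $$ (k, l)"
      using \<open>c = 0 \<or> c = 1\<close> unfolding gate_op_eq two_site_gate_entry[OF U kl] sites
      by (auto simp: p_def site_phase_def)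
  next
    fix x' k l
    assume x': "x' \<in> set [0..<L]" "x' \<noteq> x" and kl: "k < ?N" "l < ?N"
      and nz: "gate_op L U (\<phi>(p := 0)) (2 * s + 1) x' $$ (k, l) \<noteq> 0"
    \<comment> \<open>The other gates of the layer act on different sites and leave the bit at
      \<open>2 * x + c\<close> unchanged, hence they commute with the phase there.\<close>
    have "\<forall>j<2*L. j \<noteq> 2 * x' \<and> j \<noteq> 2 * x' + 1 \<longrightarrow> bit k j = bit l j"
      using nz unfolding gate_op_eq two_site_op_entry[OF kl] sites
      by (simp split: if_split_asm)
    moreover have "2 * x + c < 2 * L" "2 * x + c \<noteq> 2 * x'" "2 * x + c \<noteq> 2 * x' + 1"
      using x x' c by presburger+
    ultimately show "?d l = ?d k" by (simp add: site_phase_def)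
  qed (use x kl that in \<open>auto simp: gate_op_eq p_def\<close>)
  have "circuit L U (\<phi>(p := y)) (Suc s) $$ (k, l) = (\<Sum>m<?N. ?F y $$ (k, m) * R $$ (m, l))"
    unfolding split using kl R by (intro mult_mat_entry[where n = ?N and p = ?N]) auto
  also have "\<dots> = ?d k * (\<Sum>m<?N. ?F 0 $$ (k, m) * R $$ (m, l))"
    by (simp add: layer sum_distrib_left mult.assoc del: One_nat_def)
  also have "(\<Sum>m<?N. ?F 0 $$ (k, m) * R $$ (m, l)) = circuit L U (\<phi>(p := 0)) (Suc s) $$ (k, l)"
    unfolding split using kl R by (intro mult_mat_entry[where n = ?N and p = ?N, symmetric]) auto
  finally show ?thesis .
qed

section \<open>Averages over the phases\<close>

text \<open>The bound holds everywhere, not just almost everywhere, so the class is visibly closed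
  under sums and products and contains all entries of the circuit; on a finite measure it gives
  integrability at once.\<close>

definition bounded_measurable :: "'a measure \<Rightarrow> ('a \<Rightarrow> complex) \<Rightarrow> bool" where
  "bounded_measurable M f \<longleftrightarrow> f \<in> borel_measurable M \<and> (\<exists>B. \<forall>x. cmod (f x) \<le> B)"

lemma bounded_measurable_const [simp]: "bounded_measurable M (\<lambda>_. z)"
  by (auto simp: bounded_measurable_def)

lemma bounded_measurable_mult:
  assumes "bounded_measurable M f" "bounded_measurable M g"
  shows "bounded_measurable M (\<lambda>x. f x * g x)"
proof -
  obtain A B where "\<And>x. cmod (f x) \<le> A" "\<And>x. cmod (g x) \<le> B"
    using assms by (auto simp: bounded_measurable_def)
  then have "cmod (f x * g x) \<le> A * B" for x
    unfolding norm_mult by (intro mult_mono) (auto intro: order_trans[OF norm_ge_zero])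
  then show ?thesis
    using assms by (auto simp: bounded_measurable_def)
qed

lemma bounded_measurable_add:
  assumes "bounded_measurable M f" "bounded_measurable M g"
  shows "bounded_measurable M (\<lambda>x. f x + g x)"
proof -
  obtain A B where "\<And>x. cmod (f x) \<le> A" "\<And>x. cmod (g x) \<le> B"
    using assms by (auto simp: bounded_measurable_def)
  then have "cmod (f x + g x) \<le> A + B" for x
    by (rule norm_triangle_mono)
  then show ?thesis
    using assms by (auto simp: bounded_measurable_def)
qed

lemma bounded_measurable_sum:
  assumes "\<And>i. i \<in> I \<Longrightarrow> bounded_measurable M (f i)"
  shows "bounded_measurable M (\<lambda>x. \<Sum>i\<in>I. f i x)"
  using assms by (induction I rule: infinite_finite_induct) (auto intro: bounded_measurable_add)

lemma bounded_measurable_cnj: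
  assumes "bounded_measurable M f"
  shows "bounded_measurable M (\<lambda>x. cnj (f x))"
proof -
  have "cnj \<in> borel_measurable borel"
    by (intro borel_measurable_continuous_onI continuous_intros)
  then show ?thesis
    using assms by (auto simp: bounded_measurable_def intro: measurable_compose)
qed

lemma bounded_measurable_cis:
  assumes "f \<in> borel_measurable M"
  shows "bounded_measurable M (\<lambda>x. cis (f x))"
proof -
  have "cis \<in> borel_measurable borel"
    by (intro borel_measurable_continuous_onI continuous_intros)
  then have "(\<lambda>x. cis (f x)) \<in> borel_measurable M"
    using assms by (rule measurable_compose[rotated])
  then show ?thesis
    by (auto simp: bounded_measurable_def intro!: exI[of _ 1])
qed

lemma (in finite_measure) integrable_bounded_measurable:
  "bounded_measurable M f \<Longrightarrow> integrable M f"
  by (auto simp: bounded_measurable_def intro: integrable_const_bound)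

section \<open>The phase distribution and integrability of circuit entries\<close>

abbreviation phase_dist :: "real measure" where
  "phase_dist \<equiv> uniform_measure lborel {-pi..pi}"

lemma prob_space_phase_dist: "prob_space phase_dist"
  by (rule prob_space_uniform_measure) auto

lemma prob_space_phase_measure: "prob_space (phase_measure L t)"
  unfolding phase_measure_def by (intro prob_space_PiM prob_space_phase_dist)

lemma integrable_phase_measure:
  "bounded_measurable (phase_measure L t) f \<Longrightarrow> integrable (phase_measure L t) f"
  by (intro finite_measure.integrable_bounded_measurable prob_space.finite_measure
      prob_space_phase_measure)

lemma measurable_phase:
  assumes "p \<in> phase_labels L t"
  shows "(\<lambda>\<phi>. \<phi> p) \<in> borel_measurable (phase_measure L t)"
proof -
  have "(\<lambda>\<phi>. \<phi> p) \<in> measurable (phase_measure L t) phase_dist"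
    unfolding phase_measure_def by (rule measurable_component_singleton[OF assms])
  also have "measurable (phase_measure L t) phase_dist = borel_measurable (phase_measure L t)"
    by (rule measurable_cong_sets) auto
  finally show ?thesis .
qed

lemma bounded_measurable_site_phase:
  assumes "p \<in> phase_labels L t"
  shows "bounded_measurable (phase_measure L t) (\<lambda>\<phi>. site_phase j (\<phi> p) k)"
  unfolding site_phase_def using measurable_phase[OF assms]
  by (intro bounded_measurable_cis) (cases "bit k j"; simp)

lemma bounded_measurable_mult_mat:
  assumes "\<And>\<phi>. F \<phi> \<in> carrier_mat N N" "\<And>\<phi>. G \<phi> \<in> carrier_mat N N"
    and "\<And>k l. k < N \<Longrightarrow> l < N \<Longrightarrow> bounded_measurable M (\<lambda>\<phi>. F \<phi> $$ (k, l))"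
    and "\<And>k l. k < N \<Longrightarrow> l < N \<Longrightarrow> bounded_measurable M (\<lambda>\<phi>. G \<phi> $$ (k, l))"
    and "k < N" "l < N"
  shows "bounded_measurable M (\<lambda>\<phi>. (F \<phi> * G \<phi>) $$ (k, l))"
  unfolding mult_mat_entry[OF assms(1,2,5,6)]
  using assms by (intro bounded_measurable_sum bounded_measurable_mult) auto

lemma bounded_measurable_layer:
  assumes U: "U \<in> carrier_mat 4 4" and n: "n < 2 * t" and kl: "k < hdim L" "l < hdim L"
  shows "bounded_measurable (phase_measure L t) (\<lambda>\<phi>. layer L U \<phi> n $$ (k, l))"
proof -
  have gate: "bounded_measurable (phase_measure L t) (\<lambda>\<phi>. gate_op L U \<phi> n x $$ (k, l))"
    if "x < L" "k < hdim L" "l < hdim L" for x k l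
    unfolding gate_op_eq two_site_gate_entry[OF U that(2,3)] using n that
    by (intro bounded_measurable_mult bounded_measurable_site_phase) (auto simp: phase_labels_def)
  have prod: "bounded_measurable (phase_measure L t) (\<lambda>\<phi>. mat_list_prod (hdim L) (gate_op L U \<phi> n) xs $$ (k, l))"
    if "set xs \<subseteq> {..<L}" for xs
    using that kl
  proof (induction xs arbitrary: k l)
    case (Cons x xs)
    then show ?case
      unfolding mat_list_prod_simps
      by (intro bounded_measurable_mult_mat[where N = "hdim L"] mat_list_prod_carrier gate) auto
  qed simp
  have "set [0..<L] \<subseteq> {..<L}" by auto
  from prod[OF this] show ?thesis unfolding layer_def .
qed

lemma bounded_measurable_circuit:
  assumes U: "U \<in> carrier_mat 4 4" and "s \<le> t" "k < hdim L" "l < hdim L"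
  shows "bounded_measurable (phase_measure L t) (\<lambda>\<phi>. circuit L U \<phi> s $$ (k, l))"
  using assms(2-)
proof (induction s arbitrary: k l)
  case (Suc s)
  then show ?case
    unfolding circuit.simps
    by (intro bounded_measurable_mult_mat[where N = "hdim L"] mult_carrier_mat[of _ "hdim L" "hdim L" _ "hdim L"]
        bounded_measurable_layer U) auto
qed simp

text \<open>A nontrivial character of the circle integrates to zero over a full period: its
  antiderivative takes the same value at both ends.\<close>

lemma integral_phase_dist_cis:
  fixes m :: int
  assumes m: "m \<noteq> 0"
  shows "(\<integral>y. cis (of_int m * y) \<partial>phase_dist) = 0"
proof -
  let ?F = "\<lambda>y::real. cis (of_int m * y) / (\<i> * of_int m)"
  have dens: "phase_dist = density lborel (\<lambda>y. ennreal (indicator {-pi..pi} y / (2 * pi)))"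
    unfolding uniform_measure_def
    by (intro density_cong) (auto simp: divide_ennreal split: split_indicator simp flip: ennreal_1)
  have cis_meas: "(\<lambda>y. cis (of_int m * y)) \<in> borel_measurable borel"
    by (intro borel_measurable_continuous_onI continuous_intros)
  have "(\<integral>y. cis (of_int m * y) \<partial>phase_dist) =
        (\<integral>y. (indicator {-pi..pi} y / (2 * pi)) *\<^sub>R cis (of_int m * y) \<partial>lborel)"
    unfolding dens using cis_meas by (subst integral_density) auto
  also have "\<dots> = (\<integral>y. (1 / (2 * pi)) *\<^sub>R (indicator {-pi..pi} y *\<^sub>R cis (of_int m * y)) \<partial>lborel)"
    by (intro Bochner_Integration.integral_cong refl) simp
  also have "\<dots> = (1 / (2 * pi)) *\<^sub>R (\<integral>y. indicator {-pi..pi} y *\<^sub>R cis (of_int m * y) \<partial>lborel)"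
    by (rule integral_scaleR_right)
  also have "(\<integral>y. indicator {-pi..pi} y *\<^sub>R cis (of_int m * y) \<partial>lborel) = ?F pi - ?F (- pi)"
  proof (rule integral_FTC_atLeastAtMost)
    fix x :: real
    have "((\<lambda>z. exp (\<i> * of_int m * z) / (\<i> * of_int m)) has_field_derivative
            exp (\<i> * of_int m * of_real x)) (at (of_real x))"
      using m by (auto intro!: derivative_eq_intros)
    from has_vector_derivative_real_field[OF this]
    show "(?F has_vector_derivative cis (of_int m * x)) (at x within {-pi..pi})"
      by (simp add: cis_conv_exp mult_ac)
  qed (auto intro!: continuous_intros)
  \<comment> \<open>The cosine is even, and the sine vanishes at integer multiples of
    \<open>pi\<close>.\<close>
  also have "cis (of_int m * pi) = cis (of_int m * - pi)"
    by (simp add: complex_eq_iff mult.commute[of _ pi])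
  finally show ?thesis by simp
qed

text \<open>Two distinct basis states differ at some site, and the phase on that site averages to zero.\<close>

lemma circuit_diagonal_uncorrelated:
  assumes U: "U \<in> carrier_mat 4 4" and t: "t > 0"
    and kl: "k < hdim L" "l < hdim L" "k \<noteq> l"
  shows "(\<integral>\<phi>. circuit L U \<phi> t $$ (k, k) * cnj (circuit L U \<phi> t $$ (l, l)) \<partial>phase_measure L t) = 0"
proof -
  \<comment> \<open>Positivity of \<open>t\<close> provides a last layer whose phases can be
    averaged.\<close>
  obtain s where s: "t = Suc s" using t by (cases t) auto
  obtain j where j: "j < 2 * L" "bit k j \<noteq> bit l j"
    using kl bit_eq_below_iff[of k "2 * L" l] by (auto simp: hdim_def)
  define x c where "x = j div 2" and "c = j mod 2"
  have xc: "x < L" "c < 2" "j = 2 * x + c" using j by (auto simp: x_def c_def)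
  \<comment> \<open>The last layer is odd and acts on the pairs \<open>2 * x\<close>,
    \<open>2 * x + 1\<close>, so \<open>p\<close> labels exactly the phase on the distinguishing
    site \<open>j\<close>.\<close>
  define p :: phase_label where "p = (2 * s + 1, x, c)"
  define I where "I = phase_labels L t - {p}"
  have I: "finite I" "p \<notin> I" "phase_labels L t = insert p I"
    using xc s by (auto simp: I_def p_def phase_labels_def)
  interpret product_sigma_finite "\<lambda>_ :: phase_label. phase_dist"
    by (intro product_sigma_finite.intro prob_space_imp_sigma_finite prob_space_phase_dist)
  let ?f = "\<lambda>\<phi>. circuit L U \<phi> t $$ (k, k) * cnj (circuit L U \<phi> t $$ (l, l))"
  have inner: "(\<integral>y. ?f (\<phi>(p := y)) \<partial>phase_dist) = 0" for \<phi>
  proof -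
    \<comment> \<open>The signs at site \<open>j\<close> are opposite for \<open>k\<close> and
      \<open>l\<close>, and conjugation flips one of them, so the phases add up instead of
      cancelling.\<close>
    define m :: int where "m = (if bit k j then -2 else 2)"
    have phase: "site_phase j y k * cnj (site_phase j y l) = cis (of_int m * y)" for y
      using j(2) by (auto simp: site_phase_def m_def cis_cnj cis_mult)
    have "?f (\<phi>(p := y)) = cis (of_int m * y) * ?f (\<phi>(p := 0))" for y
      using circuit_last_phase[OF U xc(1,2) kl(1) kl(1), of \<phi> s y]
        circuit_last_phase[OF U xc(1,2) kl(2) kl(2), of \<phi> s y]
      unfolding s p_def by (simp add: phase[symmetric] xc(3) del: circuit.simps)
    then have "(\<integral>y. ?f (\<phi>(p := y)) \<partial>phase_dist) =
        (\<integral>y. cis (of_int m * y) * ?f (\<phi>(p := 0)) \<partial>phase_dist)"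
      by (rule Bochner_Integration.integral_cong[OF refl])
    also have "\<dots> = (\<integral>y. cis (of_int m * y) \<partial>phase_dist) * ?f (\<phi>(p := 0))"
      by (rule integral_mult_left_zero)
    also have "\<dots> = 0" by (simp add: integral_phase_dist_cis m_def)
    finally show ?thesis .
  qed
  have "integrable (phase_measure L t) ?f"
    using U kl by (intro integrable_phase_measure bounded_measurable_mult bounded_measurable_cnj
        bounded_measurable_circuit) auto
  \<comment> \<open>Fubini: the coordinate \<open>p\<close> is integrated first, all others being
    fixed.\<close>
  then have "(\<integral>\<phi>. ?f \<phi> \<partial>phase_measure L t) =
      (\<integral>\<phi>. (\<integral>y. ?f (\<phi>(p := y)) \<partial>phase_dist) \<partial>Pi\<^sub>M I (\<lambda>_. phase_dist))"
    unfolding phase_measure_def I(3) using I(1,2) by (rule product_integral_insert[rotated 2])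
  also have "\<dots> = 0" by (simp add: inner)
  finally show ?thesis .
qed

section \<open>Traces over the basis of Pauli strings\<close>

definition z_sign :: "nat \<Rightarrow> nat \<Rightarrow> complex" where
  "z_sign a k = (if bit k a then - 1 else 1)"

section \<open>Pauli strings as diagonal matrices, and their characters\<close>

lemma diag_mult_mat_entry:
  assumes D: "D \<in> carrier_mat N N" "\<And>k l. k < N \<Longrightarrow> l < N \<Longrightarrow> D $$ (k, l) = (if k = l then d k else 0)"
    and A: "A \<in> carrier_mat N M" and kl: "k < N" "l < M"
  shows "(D * A) $$ (k, l) = d k * A $$ (k, l)"
proof -
  have "(D * A) $$ (k, l) = (\<Sum>m<N. if m = k then d k * A $$ (k, l) else 0)"
    unfolding mult_mat_entry[OF D(1) A kl] using D(2) kl by (intro sum.cong) auto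
  then show ?thesis using kl by simp
qed

lemma one_site_op_carrier [simp]: "one_site_op L a A \<in> carrier_mat (hdim L) (hdim L)"
  by (simp add: one_site_op_def)

lemma one_site_op_entry:
  assumes "k < hdim L" "l < hdim L"
  shows "one_site_op L a A $$ (k, l) =
    (if \<forall>j<2*L. j \<noteq> a \<longrightarrow> bit k j = bit l j then A $$ (of_bool (bit k a), of_bool (bit l a)) else 0)"
  using assms by (simp add: one_site_op_def)

lemma pauli_z_entry:
  "pauli_z $$ (of_bool p, of_bool q) = (if p = q then if p then - 1 else 1 else 0)"
  by (cases p; cases q) (simp_all add: pauli_z_def mat_of_rows_list_def)

lemma one_site_op_pauli_z_entry:
  assumes "k < hdim L" "l < hdim L"
  shows "one_site_op L a pauli_z $$ (k, l) = (if k = l then z_sign a k else 0)"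
proof (cases "\<forall>j<2*L. j \<noteq> a \<longrightarrow> bit k j = bit l j")
  case True
  have "bit k a = bit l a \<longleftrightarrow> k = l"
    using assms bit_eq_below_iff[of k "2 * L" l] True by (auto simp: hdim_def)
  then show ?thesis
    unfolding one_site_op_entry[OF assms] if_P[OF True] pauli_z_entry by (simp add: z_sign_def)
next
  case False
  then have "k \<noteq> l" by auto
  then show ?thesis
    unfolding one_site_op_entry[OF assms] if_not_P[OF False] by simp
qed

lemma z_string_carrier [simp]: "z_string L X \<in> carrier_mat (hdim L) (hdim L)"
  unfolding z_string_def by (intro mat_list_prod_carrier) simp

lemma z_string_empty: "z_string L {} = 1\<^sub>m (hdim L)"
  by (simp add: z_string_def)

lemma z_string_entry:
  assumes X: "finite X" and kl: "k < hdim L" "l < hdim L"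
  shows "z_string L X $$ (k, l) = (if k = l then \<Prod>x\<in>X. z_sign x k else 0)"
proof -
  \<comment> \<open>The induction runs over arbitrary distinct lists, since the tail of a sorted
    enumeration of \<open>X\<close> enumerates another set.\<close>
  have "mat_list_prod (hdim L) (\<lambda>x. one_site_op L x pauli_z) xs $$ (k, l) =
      (if k = l then \<Prod>x\<in>set xs. z_sign x k else 0)" if "distinct xs" for xs
    using that
  proof (induction xs)
    case (Cons x xs)
    have "mat_list_prod (hdim L) (\<lambda>x. one_site_op L x pauli_z) (x # xs) $$ (k, l) =
        z_sign x k * mat_list_prod (hdim L) (\<lambda>x. one_site_op L x pauli_z) xs $$ (k, l)"
      unfolding mat_list_prod_simps using kl
      by (intro diag_mult_mat_entry[where N = "hdim L" and M = "hdim L"] mat_list_prod_carrier)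
        (auto simp: one_site_op_pauli_z_entry)
    then show ?case using Cons by simp
  qed (use kl in simp)
  then show ?thesis using X by (simp add: z_string_def)
qed

lemma mat_trace_autocorrelation:
  assumes C: "C \<in> carrier_mat (hdim L) (hdim L)" and X: "finite X"
  shows "mat_trace (z_string L X * (mat_adjoint C * z_string L X * C)) =
    (\<Sum>k<hdim L. \<Sum>l<hdim L. (\<Prod>x\<in>X. z_sign x k * z_sign x l) * (C $$ (l, k) * cnj (C $$ (l, k))))"
proof -
  let ?N = "hdim L" and ?Z = "z_string L X"
  let ?\<chi> = "\<lambda>k. \<Prod>x\<in>X. z_sign x k"
  have adj: "mat_adjoint C \<in> carrier_mat ?N ?N" using C by simp
  have ZC: "?Z * C \<in> carrier_mat ?N ?N" using C by (intro mult_carrier_mat[of _ ?N ?N _ ?N]) auto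
  have M: "mat_adjoint C * (?Z * C) \<in> carrier_mat ?N ?N"
    using adj ZC by (rule mult_carrier_mat)
  have assoc: "mat_adjoint C * ?Z * C = mat_adjoint C * (?Z * C)"
    using adj C by (intro assoc_mult_mat[of _ ?N ?N _ ?N _ ?N]) auto
  have left: "(?Z * A) $$ (k, l) = ?\<chi> k * A $$ (k, l)"
    if "A \<in> carrier_mat ?N ?N" "k < ?N" "l < ?N" for A k l
    using that X by (intro diag_mult_mat_entry[where N = ?N and M = ?N]) (auto simp: z_string_entry)
  have "mat_trace (?Z * (mat_adjoint C * (?Z * C))) =
      (\<Sum>k<?N. ?\<chi> k * (mat_adjoint C * (?Z * C)) $$ (k, k))"
    unfolding mat_trace_def using carrier_matD(1)[OF z_string_carrier[of L X]]
    by (intro sum.cong) (auto simp: left[OF M] simp del: index_mult_mat(1))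
  also have "\<dots> = (\<Sum>k<?N. ?\<chi> k * (\<Sum>l<?N. cnj (C $$ (l, k)) * (?\<chi> l * C $$ (l, k))))"
    using C by (intro sum.cong refl arg_cong2[where f = "(*)"])
      (auto simp: mult_mat_entry[OF adj ZC] left simp del: index_mult_mat(1) intro!: sum.cong)
  also have "\<dots> = (\<Sum>k<?N. \<Sum>l<?N. (\<Prod>x\<in>X. z_sign x k * z_sign x l) * (C $$ (l, k) * cnj (C $$ (l, k))))"
    by (simp add: sum_distrib_left prod.distrib mult_ac)
  finally show ?thesis unfolding assoc .
qed

text \<open>Orthogonality of characters: the subset sum is the expansion of a product over sites of
  \<open>z_sign x k * z_sign x l + 1\<close>, which is \<open>2\<close> where the bits agree and
  \<open>0\<close> where they differ.\<close>

lemma sum_z_strings: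
  assumes kl: "k < hdim L" "l < hdim L"
  shows "(\<Sum>X\<in>Pow {..<2*L}. \<Prod>x\<in>X. z_sign x k * z_sign x l) = (if k = l then 2 ^ (2*L) else 0)"
proof -
  have "(\<Sum>X\<in>Pow {..<2*L}. \<Prod>x\<in>X. z_sign x k * z_sign x l) = (\<Prod>x<2*L. z_sign x k * z_sign x l + 1)"
    by (subst prod_add) simp_all
  also have "\<dots> = (\<Prod>x<2*L. if bit k x = bit l x then 2 else 0)"
    by (intro prod.cong) (auto simp: z_sign_def)
  also have "\<dots> = (if k = l then 2 ^ (2*L) else 0)"
  proof (cases "k = l")
    case False
    then obtain j where "j < 2 * L" "bit k j \<noteq> bit l j"
      using kl bit_eq_below_iff[of k "2 * L" l] by (auto simp: hdim_def)
    then show ?thesis using False by (auto intro!: prod_zero)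
  qed simp
  finally show ?thesis .
qed

text \<open>An idempotent acts as the identity on its range, so full range leaves only the identity
  matrix; this settles the uniqueness required by \<open>THE\<close>.\<close>

lemma orth_projector_carrier_vec: "orth_projector N (carrier_vec N) = 1\<^sub>m N"
  unfolding orth_projector_def
proof (rule the_equality)
  have "mat_adjoint (1\<^sub>m N) = (1\<^sub>m N :: complex mat)"
    by (intro eq_matI) auto
  moreover have "(\<lambda>v. 1\<^sub>m N *\<^sub>v v) ` carrier_vec N = (carrier_vec N :: complex Matrix.vec set)"
    by (force simp: image_iff)
  ultimately show "mat_hermitian N (1\<^sub>m N) \<and> 1\<^sub>m N * 1\<^sub>m N = (1\<^sub>m N :: complex mat) \<and>
      (\<lambda>v. 1\<^sub>m N *\<^sub>v v) ` carrier_vec N = (carrier_vec N :: complex Matrix.vec set)"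
    by (simp add: mat_hermitian_def)
next
  fix P :: "complex mat"
  assume P: "mat_hermitian N P \<and> P * P = P \<and> (\<lambda>v. P *\<^sub>v v) ` carrier_vec N = carrier_vec N"
  then have carr: "P \<in> carrier_mat N N" by (simp add: mat_hermitian_def)
  have fix_vec: "P *\<^sub>v v = v" if v: "v \<in> carrier_vec N" for v
  proof -
    obtain w where w: "w \<in> carrier_vec N" "v = P *\<^sub>v w"
      using P v by blast
    have "P *\<^sub>v v = (P * P) *\<^sub>v w"
      unfolding w(2) using carr w(1) by (simp add: assoc_mult_mat_vec[of _ N N _ N])
    then show ?thesis using P w by simp
  qed
  show "P = 1\<^sub>m N"
  proof (rule eq_matI)
    fix i j assume "i < dim_row (1\<^sub>m N :: complex mat)" "j < dim_col (1\<^sub>m N :: complex mat)"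
    then have ij: "i < N" "j < N" by auto
    have "P $$ (i, j) = vec_index (P *\<^sub>v unit_vec N j) i"
      using carr ij by (simp add: scalar_prod_right_unit)
    also have "\<dots> = vec_index (unit_vec N j) i"
      by (simp add: fix_vec)
    finally show "P $$ (i, j) = 1\<^sub>m N $$ (i, j)"
      using ij by (simp add: unit_vec_def)
  qed (use carr in auto)
qed

section \<open>The spectral form factor\<close>

text \<open>For unitary \<open>U\<close> this is the averaged probability of passing from basis
  state \<open>l\<close> to \<open>k\<close>. It is complex-valued to match
  \<open>correlation\<close>.\<close>

definition transition :: "nat \<Rightarrow> complex mat \<Rightarrow> nat \<Rightarrow> nat \<Rightarrow> nat \<Rightarrow> complex" where
  "transition L U t k l =
    (\<integral>\<phi>. circuit L U \<phi> t $$ (k, l) * cnj (circuit L U \<phi> t $$ (k, l)) \<partial>phase_measure L t)"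

lemma integral_double_sum:
  fixes f :: "'a \<Rightarrow> 'b \<Rightarrow> 'c \<Rightarrow> complex"
  assumes "\<And>a b. a \<in> A \<Longrightarrow> b \<in> B \<Longrightarrow> integrable M (f a b)"
  shows "(\<integral>x. (\<Sum>a\<in>A. \<Sum>b\<in>B. f a b x) \<partial>M) = (\<Sum>a\<in>A. \<Sum>b\<in>B. \<integral>x. f a b x \<partial>M)"
proof -
  have "(\<integral>x. (\<Sum>a\<in>A. \<Sum>b\<in>B. f a b x) \<partial>M) = (\<Sum>a\<in>A. \<integral>x. (\<Sum>b\<in>B. f a b x) \<partial>M)"
    using assms by (intro Bochner_Integration.integral_sum Bochner_Integration.integrable_sum)
  also have "\<dots> = (\<Sum>a\<in>A. \<Sum>b\<in>B. \<integral>x. f a b x \<partial>M)"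
    using assms by (intro sum.cong refl Bochner_Integration.integral_sum)
  finally show ?thesis .
qed

lemma integrable_circuit_entries:
  assumes "U \<in> carrier_mat 4 4" "k < hdim L" "l < hdim L" "k' < hdim L" "l' < hdim L"
  shows "integrable (phase_measure L t)
    (\<lambda>\<phi>. circuit L U \<phi> t $$ (k, l) * cnj (circuit L U \<phi> t $$ (k', l')))"
  using assms by (intro integrable_phase_measure bounded_measurable_mult bounded_measurable_cnj
      bounded_measurable_circuit) auto

lemma correlation_eq_transitions:
  assumes U: "U \<in> carrier_mat 4 4" and X: "finite X"
  shows "correlation L U t X X =
    (\<Sum>k<hdim L. \<Sum>l<hdim L. (\<Prod>x\<in>X. z_sign x k * z_sign x l) * transition L U t l k) / 2 ^ (2*L)"
proof -
  have int: "integrable (phase_measure L t)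
      (\<lambda>\<phi>. (\<Prod>x\<in>X. z_sign x k * z_sign x l) * (circuit L U \<phi> t $$ (l, k) * cnj (circuit L U \<phi> t $$ (l, k))))"
    if "k \<in> {..<hdim L}" "l \<in> {..<hdim L}" for k l
    using that by (intro integrable_mult_right integrable_circuit_entries U) auto
  show ?thesis
    unfolding correlation_def mat_trace_autocorrelation[OF circuit_carrier X] integral_divide_zero
      transition_def
    by (subst integral_double_sum, rule int, assumption+, simp only: integral_mult_right_zero)
qed

lemma sum_correlation:
  assumes U: "U \<in> carrier_mat 4 4"
  shows "(\<Sum>X\<in>Pow {..<2*L}. correlation L U t X X) = (\<Sum>k<hdim L. transition L U t k k)"
proof -
  let ?N = "hdim L"
  have "(\<Sum>X\<in>Pow {..<2*L}. correlation L U t X X) =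
      (\<Sum>X\<in>Pow {..<2*L}. \<Sum>k<?N. \<Sum>l<?N. (\<Prod>x\<in>X. z_sign x k * z_sign x l) * transition L U t l k) / 2 ^ (2*L)"
    unfolding sum_divide_distrib[of _ "Pow {..<2*L}"]
    by (intro sum.cong correlation_eq_transitions U) (auto intro: finite_subset)
  also have "(\<Sum>X\<in>Pow {..<2*L}. \<Sum>k<?N. \<Sum>l<?N. (\<Prod>x\<in>X. z_sign x k * z_sign x l) * transition L U t l k) =
      (\<Sum>k<?N. \<Sum>X\<in>Pow {..<2*L}. \<Sum>l<?N. (\<Prod>x\<in>X. z_sign x k * z_sign x l) * transition L U t l k)"
    by (rule sum.swap)
  also have "\<dots> = (\<Sum>k<?N. \<Sum>l<?N. \<Sum>X\<in>Pow {..<2*L}. (\<Prod>x\<in>X. z_sign x k * z_sign x l) * transition L U t l k)"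
    by (intro sum.cong refl sum.swap)
  \<comment> \<open>With the sum over \<open>X\<close> innermost, character orthogonality removes
    all transitions between distinct states; the factor \<open>2 ^ (2*L)\<close> cancels the trace
    normalisation.\<close>
  also have "\<dots> = (\<Sum>k<?N. \<Sum>l<?N. if l = k then 2 ^ (2*L) * transition L U t k k else 0)"
    unfolding sum_distrib_right[symmetric]
    by (intro sum.cong refl, subst sum_z_strings) auto
  also have "\<dots> = 2 ^ (2*L) * (\<Sum>k<?N. transition L U t k k)"
    by (simp add: sum_distrib_left)
  finally show ?thesis by simp
qed

text \<open>Expanding the squared modulus of the trace gives a double sum over basis states, whose
  off-diagonal terms average to zero.\<close>

lemma Kg_eq_return_probabilities:
  assumes U: "U \<in> carrier_mat 4 4" and t: "t > 0"
  shows "complex_of_real (Kg L U (carrier_vec (hdim L)) t) = (\<Sum>k<hdim L. transition L U t k k)"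
proof -
  let ?N = "hdim L" and ?c = "\<lambda>\<phi> k. circuit L U \<phi> t $$ (k, k)"
  have "sector_trace ?N (carrier_vec ?N) (circuit L U \<phi> t) = (\<Sum>k<?N. ?c \<phi> k)" for \<phi>
    using carrier_matD[OF circuit_carrier[of L U \<phi> t]]
    by (simp add: sector_trace_def orth_projector_carrier_vec left_mult_one_mat[of _ ?N ?N] mat_trace_def)
  then have "complex_of_real (Kg L U (carrier_vec ?N) t) =
      (\<integral>\<phi>. complex_of_real ((cmod (\<Sum>k<?N. ?c \<phi> k))\<^sup>2) \<partial>phase_measure L t)"
    unfolding Kg_def by (simp only: integral_complex_of_real)
  also have "\<dots> = (\<integral>\<phi>. (\<Sum>k<?N. \<Sum>l<?N. ?c \<phi> k * cnj (?c \<phi> l)) \<partial>phase_measure L t)"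
    by (simp only: complex_norm_square cnj_sum sum_product)
  also have "\<dots> = (\<Sum>k<?N. \<Sum>l<?N. \<integral>\<phi>. ?c \<phi> k * cnj (?c \<phi> l) \<partial>phase_measure L t)"
    by (intro integral_double_sum integrable_circuit_entries U) auto
  also have "\<dots> = (\<Sum>k<?N. \<Sum>l<?N. if l = k then transition L U t k k else 0)"
  proof (intro sum.cong refl)
    fix k l assume "k \<in> {..<?N}" "l \<in> {..<?N}"
    then show "(\<integral>\<phi>. ?c \<phi> k * cnj (?c \<phi> l) \<partial>phase_measure L t) =
        (if l = k then transition L U t k k else 0)"
      using circuit_diagonal_uncorrelated[OF U t, of k L l] by (cases "l = k") (simp_all add: transition_def)
  qed
  also have "\<dots> = (\<Sum>k<?N. transition L U t k k)"
    by simp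
  finally show ?thesis .
qed

lemma sum_Kg_part: "(\<Sum>m=0..2*L. Kg_part L U m t) = (\<Sum>X\<in>Pow {..<2*L}. correlation L U t X X)"
proof -
  have "(\<Sum>m=0..2*L. \<Sum>X | X \<in> Pow {..<2*L} \<and> card X = m. correlation L U t X X) =
      (\<Sum>X\<in>Pow {..<2*L}. correlation L U t X X)"
    \<comment> \<open>Subsets are grouped by cardinality, which is at most \<open>2 * L\<close>, so
      no group is missed.\<close>
    by (rule sum.group) (auto dest: card_mono[rotated])
  then show ?thesis by (simp add: Kg_part_def)
qed

text \<open>The empty string is the identity, so unitarity makes the integrand constantly
  \<open>1\<close>, and the phases have a probability distribution.\<close>

lemma Kg_part_0:
  assumes U: "mat_unitary 4 U"
  shows "Kg_part L U 0 t = 1"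
proof -
  let ?N = "hdim L"
  interpret prob_space "phase_measure L t" by (rule prob_space_phase_measure)
  have "mat_trace (z_string L {} * (mat_adjoint (circuit L U \<phi> t) * z_string L {} * circuit L U \<phi> t)) = 2 ^ (2*L)"
    for \<phi>
  proof -
    have adj: "mat_adjoint (circuit L U \<phi> t) \<in> carrier_mat ?N ?N" by simp
    have "mat_adjoint (circuit L U \<phi> t) * circuit L U \<phi> t = 1\<^sub>m ?N"
      using mat_unitary_circuit[OF U] by (simp add: mat_unitary_def)
    then show ?thesis
      unfolding z_string_empty right_mult_one_mat[OF adj] by (simp add: mat_trace_def hdim_def)
  qed
  then have "correlation L U t {} {} = 1"
    by (simp add: correlation_def prob_space)
  \<comment> \<open>\<open>card\<close> is also \<open>0\<close> on infinite sets; these are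
    excluded by inclusion in a finite set.\<close>
  moreover have "{X. X \<subseteq> {..<2*L} \<and> card X = 0} = {{}}"
    by (auto dest: finite_subset)
  ultimately show ?thesis by (simp add: Kg_part_def)
qed

theorem mainTheorem1:
  fixes L t :: nat and U :: "complex mat" and V :: "complex Matrix.vec set"
  assumes "L \<ge> 1" and "t > 0"
    and "mat_unitary 4 U"
    and "no_conserved_charges L U"
    and "symmetry_sector L U V"
  shows "complex_of_real (Kg L U V t) = (\<Sum>m=0..2*L. Kg_part L U m t)
       \<and> complex_of_real (Kg L U V t) = 1 + (\<Sum>m=1..2*L. Kg_part L U m t)
       \<and> Kg_part L U 0 t = 1"
proof -
  have U: "U \<in> carrier_mat 4 4" using assms(3) by (simp add: mat_unitary_def)
  \<comment> \<open>Without charges the only sector is the whole Hilbert space.\<close>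
  have V: "V = carrier_vec (hdim L)"
    using symmetry_sector_no_charges[OF assms(4)] assms(5) by simp
  have "complex_of_real (Kg L U V t) = (\<Sum>m=0..2*L. Kg_part L U m t)"
    unfolding V sum_Kg_part sum_correlation[OF U] by (rule Kg_eq_return_probabilities[OF U assms(2)])
  moreover have "(\<Sum>m=0..2*L. Kg_part L U m t) = Kg_part L U 0 t + (\<Sum>m=1..2*L. Kg_part L U m t)"
    by (simp add: sum.atLeast_Suc_atMost)
  ultimately show ?thesis
    using Kg_part_0[OF assms(3)] by simp
qed

end
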